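(* There is no continuous graph homomorphism from $(\mathbb{X}_3,K_3)$ to $(\mathbb{W}_3,L_3)$.
   Context: $T_3=\mathbb{N}^{\le 3}$ is the tree of all sequences of natural numbers of length at most $3$; its set of leaves is $\mathcal{L}_3=\mathbb{N}^3$. $2^{\mathcal{L}_3}$ carries the product topology. For $x\in 2^{\mathcal{L}_3}$, $T^x\colon T_3\to\{0,1\}$ is defined by recursion: $T^x(\sigma)=x(\sigma)$ for leaves $\sigma$; for $\sigma$ not a leaf, $T^x(\sigma)=0$ iff there is some $k$ with $T^x(\sigma^\frown k)=1$. Write $T^x(m)=T^x(\langle m\rangle)$, $T^x(m,k)=T^x(\langle m,k\rangle)$. Let $n^x=\sup\{n : (\forall m<n)\ T^x(m)=0\}\in\omega\cup\{\omega\}$, and for $m<n^x$ let $k^x(m)$ be the least $k$ such that $T^x(m,k)=1$. $(M_k)_{k\in\mathbb{N}}$ is a fixed uniformly computable, dense list of elements of Cantor space $2^\omega$. A number $k$ codes a finite binary string $\zeta$ if $\zeta$ is an initial segment of $M_k$. $\mathbb{X}_3=2^{\mathcal{L}_3}\times \mathcal{P}(\mathbb{N})$ (both factors with the Cantor topology; subsets of $\mathbb{N}$ are identified with their characteristic functions). $K_3$ is the directed graph on $\mathbb{X}_3$ with an edge from $(x,y)$ to $(x',y')$ iff $x'=x$, $T^x(\langle\rangle)=0$, $y\bigtriangleup y'=\{n^x\}$ and $n^x\notin y$. $\mathbb{W}_3$ is the set of $(x,y)\in\mathbb{X}_3$ such that for all $m<n^x$, $k^x(m)$ codes $y\restriction(m+1)$,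 with the subspace topology. $L_3$ is the restriction of $K_3$ to $\mathbb{W}_3$. A graph homomorphism is a map sending directed edges to directed edges. *)

theory Defs
  imports "HOL-Analysis.Analysis"
begin

text \<open>Partial recursive functions, with a big-step evaluation relation:
  \<open>recf_eval p xs y\<close> says that program \<open>p\<close> on input \<open>xs\<close> halts with output \<open>y\<close>.\<close>

datatype recf = Zero | Succ | Proj nat | Comp recf "recf list" | Prec recf recf | Mu recf

inductive recf_eval :: "recf \<Rightarrow> nat list \<Rightarrow> nat \<Rightarrow> bool" where
  zero: "recf_eval Zero xs 0"
| succ: "recf_eval Succ [n] (Suc n)"
| proj: "i < length xs \<Longrightarrow> recf_eval (Proj i) xs (xs ! i)"
| comp: "list_all2 (\<lambda>g y. recf_eval g xs y) gs ys \<Longrightarrow> recf_eval f ys z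
           \<Longrightarrow> recf_eval (Comp f gs) xs z"
| prec_0: "recf_eval f xs y \<Longrightarrow> recf_eval (Prec f g) (0 # xs) y"
| prec_Suc: "recf_eval (Prec f g) (n # xs) r \<Longrightarrow> recf_eval g (n # r # xs) y
           \<Longrightarrow> recf_eval (Prec f g) (Suc n # xs) y"
| mu: "recf_eval f (n # xs) 0 \<Longrightarrow> (\<forall>i<n. \<exists>v. recf_eval f (i # xs) (Suc v))
           \<Longrightarrow> recf_eval (Mu f) xs n"

text \<open>Elements of Cantor space are functions \<open>nat \<Rightarrow> bool\<close>, with the library's product topology of
  the discrete space \<open>bool\<close>; the bit 1 is \<open>True\<close>.\<close>

definition uniformly_computable :: "(nat \<Rightarrow> nat \<Rightarrow> bool) \<Rightarrow> bool" where
  "uniformly_computable M \<longleftrightarrow>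
     (\<exists>p. \<forall>k i. recf_eval p [k, i] (of_bool (M k i)))"

definition codes :: "(nat \<Rightarrow> nat \<Rightarrow> bool) \<Rightarrow> nat \<Rightarrow> bool list \<Rightarrow> bool" where
  "codes M k \<zeta> \<longleftrightarrow> (\<forall>i < length \<zeta>. \<zeta> ! i = M k i)"

text \<open>Nodes of the tree are lists of length at most 3, its leaves being given as triples.
  On longer lists, which are not nodes, the value of \<open>T\<close> is irrelevant.\<close>

type_synonym leaf = "nat \<times> nat \<times> nat"

function T :: "(leaf \<Rightarrow> bool) \<Rightarrow> nat list \<Rightarrow> bool" where
  "T x \<sigma> = (if length \<sigma> \<ge> 3 then x (\<sigma> ! 0, \<sigma> ! 1, \<sigma> ! 2)
             else \<not> (\<exists>k. T x (\<sigma> @ [k])))"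
  by pat_completeness auto
termination by (relation "Wellfounded.measure (\<lambda>(x, \<sigma>). 3 - length \<sigma>)") auto

declare T.simps [simp del]

definition nx :: "(leaf \<Rightarrow> bool) \<Rightarrow> enat" where
  "nx x = Sup {enat n | n. \<forall>m<n. \<not> T x [m]}"

definition kx :: "(leaf \<Rightarrow> bool) \<Rightarrow> nat \<Rightarrow> nat" where
  "kx x m = (LEAST k. T x [m, k])"

text \<open>A subset of the natural numbers is represented by its characteristic function.\<close>

type_synonym X3 = "(leaf \<Rightarrow> bool) \<times> (nat \<Rightarrow> bool)"

definition K3 :: "(X3 \<times> X3) set" where
  "K3 = {((x, y), (x', y')). x' = x \<and> \<not> T x [] \<and>
           (\<exists>n. nx x = enat n \<and> sym_diff {i. y i} {i. y' i} = {n} \<and> \<not> y n)}"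

definition W3 :: "(nat \<Rightarrow> nat \<Rightarrow> bool) \<Rightarrow> X3 set" where
  "W3 M = {(x, y). \<forall>m. enat m < nx x \<longrightarrow> codes M (kx x m) (map y [0..<m + 1])}"

definition L3 :: "(nat \<Rightarrow> nat \<Rightarrow> bool) \<Rightarrow> (X3 \<times> X3) set" where
  "L3 M = K3 \<inter> W3 M \<times> W3 M"

definition graph_hom :: "('a \<times> 'a) set \<Rightarrow> ('b \<times> 'b) set \<Rightarrow> ('a \<Rightarrow> 'b) \<Rightarrow> bool" where
  "graph_hom E F f \<longleftrightarrow> (\<forall>p q. (p, q) \<in> E \<longrightarrow> (f p, f q) \<in> F)"

end

theory Submission
  imports Defs
begin

text \<open>
  Write \<open>f (x, y) = (g (x, y), h (x, y))\<close>. The set of \<open>x\<close> with \<open>n\<^sup>x = n\<close> is dense for every \<open>n\<close>, and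
  there \<open>g (x, y)\<close> does not change when the bit \<open>n\<close> of \<open>y\<close> is flipped; by continuity this holds for
  every \<open>x\<close>. Choose \<open>(x, y)\<close> with \<open>n\<^sup>x < \<omega>\<close> such that \<open>j = n\<^bsup>g (x, y)\<^esup>\<close> is least possible, and let
  \<open>y'\<close> be \<open>y\<close> with the bit \<open>n\<^sup>x\<close> flipped, so that \<open>h (x, y)\<close> and \<open>h (x, y')\<close> differ at \<open>j\<close>. Near \<open>x\<close>
  there is \<open>z\<close> with \<open>n\<^sup>z\<close> so large that flipping the bit \<open>n\<^sup>z\<close> does not affect \<open>h (z, y) j\<close>. Hence
  \<open>n\<^bsup>g (z, y)\<^esup> \<noteq> j\<close>, so it exceeds \<open>j\<close> by minimality, and the same number \<open>k\<^bsup>g (z, y)\<^esup> j\<close> codes the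
  restrictions to \<open>j + 1\<close> of both \<open>h (z, y)\<close> and \<open>h (z, y')\<close>, although these differ at \<open>j\<close>.
\<close>

lemma T_empty: "T x [] \<longleftrightarrow> (\<forall>m. \<not> T x [m])"
  by (subst T.simps) simp

lemma T_single: "T x [m] \<longleftrightarrow> (\<forall>k. \<not> T x [m, k])"
  by (subst T.simps) simp

lemma T_pair: "T x [m, k] \<longleftrightarrow> (\<forall>l. \<not> x (m, k, l))"
proof -
  have "T x [m, k, l] \<longleftrightarrow> x (m, k, l)" for l
    by (subst T.simps) simp
  then show ?thesis
    by (subst T.simps) simp
qed

lemma nx_eqI:
  assumes "T x [n]" and "\<And>m. m < n \<Longrightarrow> \<not> T x [m]"
  shows "nx x = enat n"
proof -
  have "{enat i | i. \<forall>m<i. \<not> T x [m]} = enat ` {..n}"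
    using assms by (auto simp: image_iff) (meson not_le)
  moreover have "Sup (enat ` {..n}) = enat n"
    by (rule Sup_eqI) auto
  ultimately show ?thesis
    unfolding nx_def by simp
qed

lemma nx_finite_imp_not_T_empty:
  assumes "nx x = enat n"
  shows "\<not> T x []"
proof
  assume "T x []"
  then have "enat (Suc n) \<le> nx x"
    unfolding nx_def T_empty by (intro Sup_upper) auto
  with assms show False by simp
qed

definition toggle :: "nat \<Rightarrow> (nat \<Rightarrow> bool) \<Rightarrow> nat \<Rightarrow> bool" where
  "toggle n y = y(n := \<not> y n)"

lemma sym_diff_toggle: "sym_diff {i. y i} {i. toggle n y i} = {n}"
  by (auto simp: toggle_def split: if_splits)

text \<open>Edges of \<open>K3\<close> only ever add an element, so the direction depends on whether
  \<open>n\<close> already belongs to \<open>y\<close>.\<close>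

lemma K3_toggle:
  assumes "nx x = enat n"
  shows "((x, y), (x, toggle n y)) \<in> K3 \<or> ((x, toggle n y), (x, y)) \<in> K3"
proof -
  have "sym_diff {i. toggle n y i} {i. y i} = {n}"
    using sym_diff_toggle[of y n] by blast
  moreover have "\<not> y n \<or> \<not> toggle n y n"
    by (simp add: toggle_def)
  ultimately show ?thesis
    using assms nx_finite_imp_not_T_empty[OF assms] sym_diff_toggle[of y n]
    by (auto simp: K3_def)
qed

lemma K3_D:
  assumes "(p, q) \<in> K3"
  obtains j where "fst p = fst q" "nx (fst q) = enat j" "snd p j \<noteq> snd q j"
proof -
  obtain x y x' y' where pq: "p = (x, y)" "q = (x', y')"
    by (metis surj_pair)
  with assms obtain n where n: "x' = x" "nx x = enat n" "sym_diff {i. y i} {i. y' i} = {n}"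
    by (auto simp: K3_def)
  then have "y n \<noteq> y' n" by blast
  with n pq show ?thesis by (intro that[of n]) auto
qed

text \<open>The right-hand side does not involve \<open>snd p\<close>, so two points of
  \<open>W3 M\<close> with the same first component agree at \<open>j\<close>.\<close>

lemma W3_D:
  assumes "p \<in> W3 M" and "enat j < nx (fst p)"
  shows "snd p j = M (kx (fst p) j) j"
proof -
  have "codes M (kx (fst p) j) (map (snd p) [0..<j + 1])"
    using assms by (auto simp: W3_def)
  then show ?thesis
    unfolding codes_def by (auto dest!: spec[of _ j] simp del: upt_Suc)
qed

text \<open>Only the cube of side \<open>i\<close> is copied from \<open>x\<close>; the default
  value outside it is chosen to force \<open>nx\<close> to be \<open>n\<close>, whatever
  \<open>x\<close> is.\<close>

definition approx :: "nat \<Rightarrow> (leaf \<Rightarrow> bool) \<Rightarrow> nat \<Rightarrow> leaf \<Rightarrow> bool" where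
  "approx n x i = (\<lambda>(m, k, l). if m < i \<and> k < i \<and> l < i then x (m, k, l) else n \<le> m)"

lemma nx_approx: "nx (approx n x i) = enat n"
proof (rule nx_eqI)
  \<comment> \<open>The last entry \<open>i\<close> leaves the cube, where the default is true in
    row \<open>n\<close>.\<close>
  have "\<exists>l. approx n x i (n, k, l)" for k
    by (rule exI[of _ i]) (simp add: approx_def)
  then show "T (approx n x i) [n]"
    by (simp add: T_single T_pair)
next
  fix m assume "m < n"
  \<comment> \<open>The middle entry \<open>i\<close> leaves the cube, where the default is false in
    rows below \<open>n\<close>.\<close>
  then have "\<forall>l. \<not> approx n x i (m, i, l)"
    by (simp add: approx_def)
  then show "\<not> T (approx n x i) [m]"
    by (auto simp: T_single T_pair)
qed

lemma tendsto_fun_eventually_constI: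
  assumes "\<And>a. eventually (\<lambda>i. X i a = x a) F"
  shows "((X :: 'i \<Rightarrow> 'a \<Rightarrow> 'b::topological_space) \<longlongrightarrow> x) F"
proof -
  have "limitin (product_topology (\<lambda>_. euclidean) UNIV) X x F"
    using tendsto_eventually[OF assms] by (simp add: limitin_componentwise)
  then show ?thesis
    by (simp add: euclidean_product_topology)
qed

lemma tendsto_fun_imp_eventually_eq:
  assumes "((X :: 'i \<Rightarrow> 'a \<Rightarrow> 'b::discrete_topology) \<longlongrightarrow> x) F"
  shows "eventually (\<lambda>i. X i a = x a) F"
proof -
  have "((\<lambda>i. X i a) \<longlongrightarrow> x a) F"
    by (rule continuous_on_tendsto_compose[OF continuous_on_product_coordinates assms]) auto
  then show ?thesis
    by (simp add: tendsto_discrete)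
qed

lemma approx_tendsto: "(\<lambda>i. approx (n i) x i) \<longlonglongrightarrow> x"
proof (rule tendsto_fun_eventually_constI)
  fix a :: leaf
  obtain m k l where a: "a = (m, k, l)" by (metis surj_pair)
  show "\<forall>\<^sub>F i in sequentially. approx (n i) x i a = x a"
    using eventually_gt_at_top[of "max m (max k l)"]
    by eventually_elim (simp add: approx_def a)
qed

lemma toggle_tendsto: "(\<lambda>i. toggle i y) \<longlonglongrightarrow> y"
proof (rule tendsto_fun_eventually_constI)
  fix m
  show "\<forall>\<^sub>F i in sequentially. toggle i y m = y m"
    using eventually_gt_at_top[of m] by eventually_elim (simp add: toggle_def)
qed

theorem proposition4p23:
  fixes M :: "nat \<Rightarrow> nat \<Rightarrow> bool"
  assumes "uniformly_computable M"
    and "closure (range M) = UNIV"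
  shows "\<not> (\<exists>f :: X3 \<Rightarrow> X3.
            continuous_map euclidean (top_of_set (W3 M)) f \<and> graph_hom K3 (L3 M) f)"
proof
  assume "\<exists>f :: X3 \<Rightarrow> X3.
    continuous_map euclidean (top_of_set (W3 M)) f \<and> graph_hom K3 (L3 M) f"
  then obtain f :: "X3 \<Rightarrow> X3"
    where cont: "continuous_on UNIV f" and W: "\<And>p. f p \<in> W3 M" and hom: "graph_hom K3 (L3 M) f"
    by (auto simp: continuous_map_in_subtopology)
  define g where "g x y = fst (f (x, y))" for x y
  define h where "h x y = snd (f (x, y))" for x y
  have f_tendsto: "(\<lambda>i. f (X i, Y i)) \<longlonglongrightarrow> f (x, y)" if "X \<longlonglongrightarrow> x" "Y \<longlonglongrightarrow> y" for X Y x y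
    using continuous_on_tendsto_compose[OF cont tendsto_Pair[OF that]] by simp
  have g_eventually: "\<forall>\<^sub>F i in sequentially. g (X i) (Y i) a = g x y a"
    if "X \<longlonglongrightarrow> x" "Y \<longlonglongrightarrow> y" for X Y x y a
    unfolding g_def by (intro tendsto_fun_imp_eventually_eq tendsto_fst f_tendsto that)
  have h_eventually: "\<forall>\<^sub>F i in sequentially. h (X i) (Y i) j = h x y j"
    if "X \<longlonglongrightarrow> x" "Y \<longlonglongrightarrow> y" for X Y x y j
    unfolding h_def by (intro tendsto_fun_imp_eventually_eq tendsto_snd f_tendsto that)
  have edge: "\<exists>j. g x (toggle n y) = g x y \<and> nx (g x y) = enat j \<and> h x (toggle n y) j \<noteq> h x y j"
    if "nx x = enat n" for x n y
  proof -
    have "(f (x, y), f (x, toggle n y)) \<in> K3 \<or> (f (x, toggle n y), f (x, y)) \<in> K3"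
      using K3_toggle[OF that, of y] hom unfolding graph_hom_def L3_def by blast
    then show ?thesis
      unfolding g_def h_def by (metis K3_D)
  qed
  have g_toggle: "g x (toggle n y) = g x y" for x n y
  proof
    fix a
    have "\<forall>\<^sub>F i in sequentially. g (approx n x i) y a = g x y a
        \<and> g (approx n x i) (toggle n y) a = g x (toggle n y) a"
      by (intro eventually_conj g_eventually approx_tendsto tendsto_const)
    then obtain i where "g (approx n x i) y a = g x y a"
        "g (approx n x i) (toggle n y) a = g x (toggle n y) a"
      by (auto dest: eventually_happens)
    moreover have "g (approx n x i) (toggle n y) = g (approx n x i) y"
      using edge[OF nx_approx] by blast
    ultimately show "g x (toggle n y) a = g x y a"
      by simp
  qed

  define P where "P j \<longleftrightarrow> (\<exists>x y n. nx x = enat n \<and> nx (g x y) = enat j)" for j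
  define j where "j = (LEAST j. P j)"
  have "\<exists>j. P j"
    unfolding P_def using edge nx_approx by blast
  then have "P j"
    unfolding j_def by (rule LeastI_ex)
  then obtain x y n where x: "nx x = enat n" "nx (g x y) = enat j"
    unfolding P_def by blast
  define y' where "y' = toggle n y"
  have differ: "h x y' j \<noteq> h x y j"
    using edge[OF x(1), of y] x(2) by (auto simp: y'_def)
  \<comment> \<open>Here the prescribed \<open>nx\<close> is the index \<open>i\<close> itself, so
    that \<open>toggle i y\<close> converges to \<open>y\<close> along with the
    approximants.\<close>
  note lim = approx_tendsto[of "\<lambda>i. i" x]
  have "\<forall>\<^sub>F i in sequentially. h (approx i x i) y j = h x y j
      \<and> h (approx i x i) (toggle i y) j = h x y j \<and> h (approx i x i) y' j = h x y' j"
    by (intro eventually_conj h_eventually lim tendsto_const toggle_tendsto)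
  then obtain i where i: "h (approx i x i) y j = h x y j"
      "h (approx i x i) (toggle i y) j = h x y j" "h (approx i x i) y' j = h x y' j"
    by (auto dest: eventually_happens)
  define z where "z = approx i x i"
  obtain r where r: "nx (g z y) = enat r" "h z (toggle i y) r \<noteq> h z y r"
    using edge[OF nx_approx] unfolding z_def by blast
  have "P r"
    unfolding P_def using r(1) nx_approx z_def by blast
  then have "j \<le> r"
    unfolding j_def by (rule Least_le)
  \<comment> \<open>Flipping bit \<open>i\<close> changes \<open>h z y\<close> at \<open>r\<close>
    but, by the choice of \<open>i\<close>, not at \<open>j\<close>.\<close>
  moreover have "r \<noteq> j"
    using r(2) i by (auto simp: z_def)
  ultimately have less: "enat j < nx (g z y)"
    using r(1) by simp
  have "h z y j = M (kx (g z y) j) j"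
    using W3_D[OF W] less by (simp add: g_def h_def)
  \<comment> \<open>The flipped bit is now \<open>n = nx x\<close>, not \<open>i = nx z\<close>.
    Thus \<open>edge\<close> need not apply at \<open>z\<close>, and \<open>g_toggle\<close> for
    arbitrary points is required.\<close>
  moreover have "h z y' j = M (kx (g z y) j) j"
    using W3_D[OF W[of "(z, y')"]] less g_toggle[of z n y] by (simp add: g_def h_def y'_def)
  ultimately show False
    using i differ by (simp add: z_def)
qed

end
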